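(* In both the $q_n$ case (with $n\ge 3$) and the $q_{n-1}$ case (with $n\ge 4$), the metric $g_f$ satisfies, at every point of $\Sigma$, $$g_f\;\ge\; g_{\mathrm{Fuchsian}}:=\tfrac{1}{6}(n^4-n^2)\,g_0 .$$ Moreover, if equality holds at one point of $\Sigma$, then $q_n\equiv 0$ (in the $q_n$ case), respectively $q_{n-1}\equiv 0$ (in the $q_{n-1}$ case).
   Context: Let $\Sigma$ be a closed Riemann surface of genus $\ge 2$ with canonical bundle $K$; $z$ is a local holomorphic coordinate and $\Delta=\partial_z\partial_{\bar z}$ is the coordinate Laplacian. A Hermitian metric on $K^{-l}$ (a positive smooth section of $K^{l}\otimes\bar K^{l}$) is written locally as $h\,dz^l d\bar z^l$ and identified with the positive local function $h$; products, powers and quotients are taken of these local functions, and an inequality between two sections of the same bundle $(K\otimes\bar K)^s$ means the (coordinate–independent) inequality of their local coefficient functions. $g_0$ is the unique Hermitian metric on $K^{-1}$ compatible with the complex structure of constant curvature $-1$; locally $\Delta\log g_0=g_0$. For a holomorphic $j$-differential $q=q\,dz^j$, $|q|^2:=q\bar q$. $q_n$ case: $n\ge 3$, $n=2m$ or $n=2m+1$, $q_n\in H^0(\Sigma,K^n)$. $E=\bigoplus_{k=1}^n K^{(n+1-2k)/2}$ with Higgs field $\phi\in H^0(\mathrm{End}(E)\otimes K)$ having entries $\phi_{k+1,k}=1$ ($1\le k\le n-1$), $\phi_{1,n}=q_n$, all others $0$. The unique determinant-one Hermitian metric $h$ on $E$ solving Hitchin's equation $F^{\nabla^h}+[\phi,\phi^{*_h}]=0$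 is diagonal, $h=\mathrm{diag}(h_1,\dots,h_m,[1],h_m^{-1},\dots,h_1^{-1})$ (middle entry $1$ only for $n$ odd), $h_k$ a Hermitian metric on $K^{(n+1-2k)/2}$, and Hitchin's equation is equivalent to the local system $\Delta\log h_k+h_k^{-1}h_{k+1}-h_{k-1}^{-1}h_k=0$ ($1\le k\le m$), with conventions $h_0^{-1}h_1:=h_1^2|q_n|^2$, and $h_{m+1}:=h_m^{-1}$ if $n=2m$, $h_{m+1}:=1$ if $n=2m+1$. Here $g_f:=2n\,\mathrm{tr}(\phi\phi^{*_h})=2n\big(h_1^2|q_n|^2+2\sum_{k=1}^{m-1}h_k^{-1}h_{k+1}+h_m^{-2}\big)$ for $n=2m$, the last term $h_m^{-2}$ being replaced by $2h_m^{-1}$ for $n=2m+1$. $q_{n-1}$ case: $n\ge 4$, $n=2m$ or $2m+1$, $q_{n-1}\in H^0(\Sigma,K^{n-1})$, same $E$, Higgs field with $\phi_{k+1,k}=1$, $\phi_{1,n-1}=\phi_{2,n}=q_{n-1}$, all others $0$. The solving metric $h$ is again diagonal of the same form and Hitchin's equation is equivalent to $\Delta\log h_1+h_1^{-1}h_2-h_1h_2|q_{n-1}|^2=0$, $\Delta\log h_2+h_2^{-1}h_3-h_1^{-1}h_2-h_1h_2|q_{n-1}|^2=0$, $\Delta\log h_k+h_k^{-1}h_{k+1}-h_{k-1}^{-1}h_k=0$ for $3\le k\le m$, with the same convention for $h_{m+1}$. Here $g_f:=2n\,\mathrm{tr}(\phi\phi^{*_h})=2n\big(2h_1h_2|q_{n-1}|^2+2\sum_{k=1}^{m-1}h_k^{-1}h_{k+1}+h_m^{-2}\big)$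 for $n=2m$, last term replaced by $2h_m^{-1}$ for $n=2m+1$. $g_f$ is the induced (pullback) Hermitian metric of the equivariant minimal immersion of $\tilde\Sigma$ into $SL(n,\mathbb C)/SU(n)$ associated to the Higgs bundle; when $q_n\equiv0$ (resp. $q_{n-1}\equiv0$) one has $g_f=\frac16(n^4-n^2)g_0$. *)

theory Defs
  imports "HOL-Analysis.Analysis"
begin

text \<open>A chart is a pair (U, phi) of an open set U of the surface and a coordinate map
  phi : U -> C. The surface itself is the (whole) carrier type 'a.\<close>

type_synonym 'a chart = "'a set \<times> ('a \<Rightarrow> complex)"

definition chart_inv :: "'a chart \<Rightarrow> complex \<Rightarrow> 'a" where
  "chart_inv c = inv_into (fst c) (snd c)"

definition transition :: "'a chart \<Rightarrow> 'a chart \<Rightarrow> complex \<Rightarrow> complex" where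
  "transition c d = snd d \<circ> chart_inv c"

definition holomorphic_atlas :: "('a::topological_space) chart set \<Rightarrow> bool" where
  "holomorphic_atlas A \<longleftrightarrow>
     \<Union>(fst ` A) = UNIV \<and>
     (\<forall>c\<in>A. open (fst c) \<and> inj_on (snd c) (fst c) \<and> open (snd c ` fst c) \<and>
            homeomorphism (fst c) (snd c ` fst c) (snd c) (chart_inv c)) \<and>
     (\<forall>c\<in>A. \<forall>d\<in>A. transition c d holomorphic_on (snd c ` (fst c \<inter> fst d)))"

definition closed_riemann_surface :: "('a::t2_space) chart set \<Rightarrow> bool" where
  "closed_riemann_surface A \<longleftrightarrow>
     compact (UNIV :: 'a set) \<and> connected (UNIV :: 'a set) \<and> holomorphic_atlas A"

fun pd :: "complex list \<Rightarrow> (complex \<Rightarrow> real) \<Rightarrow> complex \<Rightarrow> real" where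
  "pd [] u = u"
| "pd (v # vs) u = (\<lambda>z. frechet_derivative (pd vs u) (at z) v)"

definition smooth_on :: "complex set \<Rightarrow> (complex \<Rightarrow> real) \<Rightarrow> bool" where
  "smooth_on S u \<longleftrightarrow> (\<forall>vs. \<forall>z\<in>S. pd vs u differentiable (at z))"

text \<open>Coordinate Laplacian Delta = d_z d_zbar = (d_x^2 + d_y^2)/4.\<close>
definition lap :: "(complex \<Rightarrow> real) \<Rightarrow> complex \<Rightarrow> real" where
  "lap u z = (pd [1, 1] u z + pd [\<i>, \<i>] u z) / 4"

text \<open>A section of (K (x) Kbar)^s is given by its local coefficient in each chart, as a
  function of the point: F c p for p in fst c.\<close>
type_synonym 'a sect = "'a chart \<Rightarrow> 'a \<Rightarrow> real"

definition loc :: "'a sect \<Rightarrow> 'a chart \<Rightarrow> complex \<Rightarrow> real" where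
  "loc F c = F c \<circ> chart_inv c"

text \<open>Positive smooth section of (K (x) Kbar)^s, i.e. a Hermitian metric on K^{-s}:
  h_c = h_d |dz_d/dz_c|^{2s}.\<close>
definition metric_sect :: "'a chart set \<Rightarrow> real \<Rightarrow> 'a sect \<Rightarrow> bool" where
  "metric_sect A s F \<longleftrightarrow>
     (\<forall>c\<in>A. \<forall>p\<in>fst c. F c p > 0) \<and>
     (\<forall>c\<in>A. smooth_on (snd c ` fst c) (loc F c)) \<and>
     (\<forall>c\<in>A. \<forall>d\<in>A. \<forall>p\<in>fst c \<inter> fst d.
        F c p = F d p * cmod (deriv (transition c d) (snd c p)) powr (2 * s))"

definition hol_diff :: "'a chart set \<Rightarrow> nat \<Rightarrow> ('a chart \<Rightarrow> 'a \<Rightarrow> complex) \<Rightarrow> bool" where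
  "hol_diff A j Q \<longleftrightarrow>
     (\<forall>c\<in>A. (Q c \<circ> chart_inv c) holomorphic_on (snd c ` fst c)) \<and>
     (\<forall>c\<in>A. \<forall>d\<in>A. \<forall>p\<in>fst c \<inter> fst d.
        Q c p = Q d p * (deriv (transition c d) (snd c p)) ^ j)"

definition hyperbolic_metric :: "'a chart set \<Rightarrow> 'a sect \<Rightarrow> bool" where
  "hyperbolic_metric A g \<longleftrightarrow> metric_sect A 1 g \<and>
     (\<forall>c\<in>A. \<forall>p\<in>fst c. lap (ln \<circ> loc g c) (snd c p) = g c p)"

text \<open>h k (1 <= k <= m) is a Hermitian metric on K^{(n+1-2k)/2}, i.e. a positive section of
  (K (x) Kbar)^{-(n+1-2k)/2}.  m = n div 2.\<close>

text \<open>T k = h_k^{-1} h_{k+1} for 1 <= k <= m, with the convention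
  h_{m+1} = h_m^{-1} (n even), h_{m+1} = 1 (n odd).\<close>
definition Tterm :: "nat \<Rightarrow> (nat \<Rightarrow> 'a sect) \<Rightarrow> nat \<Rightarrow> 'a sect" where
  "Tterm n h k c p =
     (if k < n div 2 then h (k+1) c p / h k c p
      else if even n then 1 / (h k c p)^2 else 1 / h k c p)"

definition metrics_ok :: "'a chart set \<Rightarrow> nat \<Rightarrow> (nat \<Rightarrow> 'a sect) \<Rightarrow> bool" where
  "metrics_ok A n h \<longleftrightarrow>
     (\<forall>k\<in>{1..n div 2}. metric_sect A (- (real n + 1 - 2 * real k) / 2) (h k))"

definition qn_system :: "'a chart set \<Rightarrow> nat \<Rightarrow> ('a chart \<Rightarrow> 'a \<Rightarrow> complex)
    \<Rightarrow> (nat \<Rightarrow> 'a sect) \<Rightarrow> bool" where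
  "qn_system A n Q h \<longleftrightarrow> metrics_ok A n h \<and>
     (\<forall>c\<in>A. \<forall>p\<in>fst c. \<forall>k\<in>{1..n div 2}.
        lap (ln \<circ> loc (h k) c) (snd c p) + Tterm n h k c p
        - (if k = 1 then (h 1 c p)^2 * (cmod (Q c p))^2 else Tterm n h (k - 1) c p) = 0)"

definition gf_qn :: "nat \<Rightarrow> ('a chart \<Rightarrow> 'a \<Rightarrow> complex) \<Rightarrow> (nat \<Rightarrow> 'a sect) \<Rightarrow> 'a sect" where
  "gf_qn n Q h c p = 2 * real n *
     ((h 1 c p)^2 * (cmod (Q c p))^2
      + 2 * (\<Sum>k\<in>{1..<n div 2}. h (k+1) c p / h k c p)
      + (if even n then 1 / (h (n div 2) c p)^2 else 2 / h (n div 2) c p))"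

definition qn1_system :: "'a chart set \<Rightarrow> nat \<Rightarrow> ('a chart \<Rightarrow> 'a \<Rightarrow> complex)
    \<Rightarrow> (nat \<Rightarrow> 'a sect) \<Rightarrow> bool" where
  "qn1_system A n Q h \<longleftrightarrow> metrics_ok A n h \<and>
     (\<forall>c\<in>A. \<forall>p\<in>fst c.
        lap (ln \<circ> loc (h 1) c) (snd c p) + Tterm n h 1 c p
          - h 1 c p * h 2 c p * (cmod (Q c p))^2 = 0 \<and>
        lap (ln \<circ> loc (h 2) c) (snd c p) + Tterm n h 2 c p - Tterm n h 1 c p
          - h 1 c p * h 2 c p * (cmod (Q c p))^2 = 0 \<and>
        (\<forall>k\<in>{3..n div 2}.
          lap (ln \<circ> loc (h k) c) (snd c p) + Tterm n h k c p - Tterm n h (k - 1) c p = 0))"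

definition gf_qn1 :: "nat \<Rightarrow> ('a chart \<Rightarrow> 'a \<Rightarrow> complex) \<Rightarrow> (nat \<Rightarrow> 'a sect) \<Rightarrow> 'a sect" where
  "gf_qn1 n Q h c p = 2 * real n *
     (2 * h 1 c p * h 2 c p * (cmod (Q c p))^2
      + 2 * (\<Sum>k\<in>{1..<n div 2}. h (k+1) c p / h k c p)
      + (if even n then 1 / (h (n div 2) c p)^2 else 2 / h (n div 2) c p))"

end

theory Submission
  imports Defs
begin

text \<open>Put \<open>T\<^sub>k = h\<^sub>k\<^sup>-\<^sup>1 h\<^sub>k\<^sub>+\<^sub>1\<close> for \<open>1 \<le> k \<le> m\<close>, extended by \<open>T\<^sub>0 = 0\<close> and by reflection
  \<open>T\<^sub>n\<^sub>-\<^sub>k = T\<^sub>k\<close>. In both cases Hitchin's equation becomes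
  \<open>\<Delta> log T\<^sub>k = 2 T\<^sub>k - T\<^sub>k\<^sub>-\<^sub>1 - T\<^sub>k\<^sub>+\<^sub>1 - E\<^sub>k\<close>, where \<open>E\<^sub>k \<ge> 0\<close> involves the differential and is nonzero only
  for \<open>k = 1\<close>, respectively \<open>k = 2\<close>. The Fuchsian solution is \<open>T\<^sub>k = a\<^sub>k g\<^sub>0\<close> with \<open>a\<^sub>k = k (n - k) / 2\<close>,
  and \<open>2 a\<^sub>k - a\<^sub>k\<^sub>-\<^sub>1 - a\<^sub>k\<^sub>+\<^sub>1 = 1\<close>. Let \<open>T\<^sub>k / (a\<^sub>k g\<^sub>0)\<close> attain its minimum \<open>s\<close> over all \<open>k\<close> and all points.
  There \<open>g\<^sub>0 = \<Delta> log g\<^sub>0 \<le> \<Delta> log T\<^sub>k \<le> s g\<^sub>0\<close>, so \<open>s \<ge> 1\<close>, and summing \<open>T\<^sub>k \<ge> a\<^sub>k g\<^sub>0\<close> over \<open>k\<close> gives the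
  inequality. Equality at a point forces \<open>T\<^sub>k = a\<^sub>k g\<^sub>0\<close> at that point for every \<open>k\<close>; the strong maximum
  principle applied to \<open>log (T\<^sub>k / (a\<^sub>k g\<^sub>0)) \<ge> 0\<close> makes this an identity, and then the equation gives
  \<open>E\<^sub>k = 0\<close>.\<close>

section \<open>Maximum principles\<close>

text \<open>Weaker than \<open>smooth_on\<close> but enough for the maximum principles. It passes to
  linear combinations and logarithms by the derivative rules alone, without induction over lists of
  directions.\<close>

definition twice_diff_on :: "complex set \<Rightarrow> (complex \<Rightarrow> real) \<Rightarrow> bool" where
  "twice_diff_on S u \<longleftrightarrow>
     (\<forall>z\<in>S. u differentiable (at z) \<and> (\<forall>e. pd [e] u differentiable (at z)))"

lemma smooth_on_imp_twice_diff_on: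
  assumes "smooth_on S u"
  shows "twice_diff_on S u"
proof -
  have "pd vs u differentiable (at z)" if "z \<in> S" for z vs
    using assms that unfolding smooth_on_def by blast
  from this[of _ "[]"] this show ?thesis unfolding twice_diff_on_def pd.simps(1) by blast
qed

lemma twice_diff_on_subset: "twice_diff_on S u \<Longrightarrow> R \<subseteq> S \<Longrightarrow> twice_diff_on R u"
  unfolding twice_diff_on_def by blast

lemma twice_diff_on_imp_continuous_on: "twice_diff_on S u \<Longrightarrow> continuous_on S u"
  unfolding twice_diff_on_def
  by (auto intro!: continuous_at_imp_continuous_on differentiable_imp_continuous_within)

section \<open>Locality, linearity and logarithms for \<open>pd\<close> and
  \<open>lap\<close>\<close>

lemma has_derivative_cong_open:
  assumes "open S" "z \<in> S" "\<And>x. x \<in> S \<Longrightarrow> u x = w x"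
  shows "(u has_derivative D) (at z) \<longleftrightarrow> (w has_derivative D) (at z)"
  using assms by (auto intro: has_derivative_transform_within_open[of _ _ _ _ S])

text \<open>\<open>frechet_derivative\<close> is a choice among all derivatives at a point.
  Functions agreeing near the point have the same derivatives, hence the same choice, even where
  there is no derivative at all.\<close>

lemma pd_cong_open:
  assumes "open S" "\<And>x. x \<in> S \<Longrightarrow> u x = w x" "z \<in> S"
  shows "pd vs u z = pd vs w z"
  using assms(3)
proof (induction vs arbitrary: z)
  case (Cons v vs)
  then show ?case
    using has_derivative_cong_open[OF assms(1) Cons.prems, of "pd vs u" "pd vs w"]
    by (simp add: frechet_derivative_def)
qed (use assms in auto)

lemma lap_cong_open:
  assumes "open S" "\<And>x. x \<in> S \<Longrightarrow> u x = w x" "z \<in> S"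
  shows "lap u z = lap w z"
  unfolding lap_def by (simp only: pd_cong_open[OF assms])

lemma differentiable_cong_open:
  assumes "open S" "z \<in> S" "\<And>x. x \<in> S \<Longrightarrow> u x = w x"
  shows "u differentiable (at z) \<longleftrightarrow> w differentiable (at z)"
  unfolding differentiable_def by (simp only: has_derivative_cong_open[OF assms])

lemma twice_diff_on_cong_open:
  assumes "open S" "\<And>x. x \<in> S \<Longrightarrow> u x = w x"
  shows "twice_diff_on S u \<longleftrightarrow> twice_diff_on S w"
proof -
  have "pd vs u differentiable (at z) \<longleftrightarrow> pd vs w differentiable (at z)" if "z \<in> S" for z vs
    by (rule differentiable_cong_open[OF assms(1) that]) (rule pd_cong_open[OF assms])
  from this[of _ "[]"] this show ?thesis unfolding twice_diff_on_def pd.simps(1) by blast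
qed

lemma pd_linear_combination:
  assumes "(u :: complex \<Rightarrow> real) differentiable (at z)" "w differentiable (at z)"
  shows "pd [e] (\<lambda>x. a * u x + b * w x + d) z = a * pd [e] u z + b * pd [e] w z"
proof -
  have "((\<lambda>x. a * u x + b * w x + d) has_derivative
     (\<lambda>h. a * frechet_derivative u (at z) h + b * frechet_derivative w (at z) h)) (at z)"
    using assms[unfolded frechet_derivative_works]
    by (auto intro!: derivative_eq_intros)
  then show ?thesis
    by (simp add: frechet_derivative_at[symmetric])
qed

lemma
  assumes "open S" "twice_diff_on S u" "twice_diff_on S w"
  shows twice_diff_on_linear_combination: "twice_diff_on S (\<lambda>x. a * u x + b * w x + d)"
    and lap_linear_combination:
      "z \<in> S \<Longrightarrow> lap (\<lambda>x. a * u x + b * w x + d) z = a * lap u z + b * lap w z"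
proof -
  let ?f = "\<lambda>x. a * u x + b * w x + d"
  \<comment> \<open>The \<open>+ 0\<close> gives the first derivative the shape of \<open>?f\<close>
    itself, so that \<open>pd_linear_combination\<close> applies a second time.\<close>
  have 1: "pd [e] ?f z = a * pd [e] u z + b * pd [e] w z + 0" if "z \<in> S" for z e
    using that assms pd_linear_combination unfolding twice_diff_on_def by simp
  have 2: "?f differentiable at z \<and> pd [e] ?f differentiable at z" if "z \<in> S" for z e
  proof
    show "?f differentiable at z"
      using that assms unfolding twice_diff_on_def
      by (intro differentiable_add differentiable_mult) auto
    have "(\<lambda>z. a * pd [e] u z + b * pd [e] w z + 0) differentiable at z"
      using that assms unfolding twice_diff_on_def
      by (intro differentiable_add differentiable_mult) auto
    then show "pd [e] ?f differentiable at z"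
      by (subst differentiable_cong_open[OF assms(1) that 1]) auto
  qed
  then show "twice_diff_on S ?f" unfolding twice_diff_on_def by blast
  assume z: "z \<in> S"
  have "pd [e, e] ?f z = a * pd [e, e] u z + b * pd [e, e] w z" for e
  proof -
    have "pd [e, e] ?f z = pd [e] (pd [e] ?f) z" by simp
    also have "\<dots> = pd [e] (\<lambda>z. a * pd [e] u z + b * pd [e] w z + 0) z"
      using pd_cong_open[OF assms(1) 1 z] .
    also have "\<dots> = a * pd [e] (pd [e] u) z + b * pd [e] (pd [e] w) z"
      using z assms unfolding twice_diff_on_def by (intro pd_linear_combination) auto
    finally show ?thesis by simp
  qed
  then show "lap ?f z = a * lap u z + b * lap w z"
    unfolding lap_def by (simp add: field_simps)
qed

lemma twice_diff_on_ln:
  assumes "open S" "twice_diff_on S u" "\<And>z. z \<in> S \<Longrightarrow> u z > 0"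
  shows "twice_diff_on S (ln \<circ> u)"
proof -
  have d: "((ln \<circ> u) has_derivative (\<lambda>h. frechet_derivative u (at z) h / u z)) (at z)"
    if "z \<in> S" for z
    using that assms unfolding twice_diff_on_def o_def
    by (auto intro!: derivative_eq_intros simp: divide_inverse frechet_derivative_works)
  have 1: "pd [e] (ln \<circ> u) z = pd [e] u z / u z" if "z \<in> S" for z e
    using frechet_derivative_at[OF d[OF that], symmetric] by simp
  have "pd [e] (ln \<circ> u) differentiable at z" if "z \<in> S" for z e
  proof -
    have "(\<lambda>z. pd [e] u z / u z) differentiable at z"
      using that assms(2) assms(3)[OF that] unfolding twice_diff_on_def
      by (intro differentiable_divide) auto
    then show ?thesis by (subst differentiable_cong_open[OF assms(1) that 1]) auto
  qed
  then show ?thesis using d unfolding twice_diff_on_def differentiable_def by blast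
qed

section \<open>Second-order conditions at a minimum and the strong minimum principle in the
  plane\<close>

lemma second_derivative_nonneg_at_min:
  fixes f f' :: "real \<Rightarrow> real"
  assumes "d > 0" and f: "\<And>t. \<bar>t\<bar> < d \<Longrightarrow> DERIV f t :> f' t"
    and f': "DERIV f' 0 :> D" and min: "\<And>t. \<bar>t\<bar> < d \<Longrightarrow> f 0 \<le> f t"
  shows "D \<ge> 0"
proof (rule ccontr)
  assume "\<not> D \<ge> 0"
  have f0: "f' 0 = 0"
    using DERIV_local_min[of f "f' 0" 0 d] f[of 0] min \<open>d > 0\<close> by auto
  \<comment> \<open>If \<open>D < 0\<close>, then \<open>f'\<close> is negative just to the right of
    0, and the mean value theorem produces a value of \<open>f\<close> below
    \<open>f 0\<close>.\<close>
  obtain r where r: "r > 0" "\<And>h. 0 < h \<Longrightarrow> h < r \<Longrightarrow> f' h < 0"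
    using DERIV_neg_dec_right[OF f'] \<open>\<not> D \<ge> 0\<close> f0 by auto
  define t where "t = min d r / 2"
  have t: "0 < t" "t < d" "t < r" using \<open>d > 0\<close> r by (auto simp: t_def)
  obtain x where x: "0 < x" "x < t" "f t - f 0 = (t - 0) * f' x"
    using MVT2[of 0 t f f'] t f by auto
  have "(t - 0) * f' x < 0" using r(2)[of x] x t by (simp add: mult_pos_neg)
  then show False using x min[of t] t by auto
qed

text \<open>Restricted to any line through \<open>p\<close>, \<open>u\<close> has a minimum at
  \<open>p\<close>, so each pure second derivative is nonnegative there.\<close>

lemma lap_nonneg_at_min:
  assumes "open S" "twice_diff_on S u" "p \<in> S" and min: "\<And>z. z \<in> S \<Longrightarrow> u p \<le> u z"
  shows "lap u p \<ge> 0"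
proof -
  have "pd [e, e] u p \<ge> 0" for e
  proof -
    obtain r where r: "r > 0" "ball p r \<subseteq> S"
      using assms openE by blast
    \<comment> \<open>The \<open>+ 1\<close> keeps the denominator positive when
      \<open>e = 0\<close>.\<close>
    have inS: "p + of_real t * e \<in> S" if "\<bar>t\<bar> < r / (cmod e + 1)" for t
    proof -
      have "\<bar>t\<bar> * (cmod e + 1) < r"
        using that by (simp add: pos_less_divide_eq add_nonneg_pos)
      then have "cmod (of_real t * e) < r" by (simp add: norm_mult algebra_simps)
      then show ?thesis using r by (auto simp: dist_norm norm_minus_commute)
    qed
    have line: "DERIV (\<lambda>t. w (p + of_real t * e)) t :> pd [e] w (p + of_real t * e)"
      if w: "w differentiable (at (p + of_real t * e))" for w :: "complex \<Rightarrow> real" and t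
    proof -
      have D: "(w has_derivative frechet_derivative w (at (p + of_real t * e)))
          (at (p + of_real t * e))"
        using w[unfolded frechet_derivative_works] .
      have "((\<lambda>t. p + of_real t * e) has_derivative (\<lambda>h. of_real h * e)) (at t)"
        by (auto intro!: derivative_eq_intros)
      from diff_chain_at[OF this D]
      have "((\<lambda>t. w (p + of_real t * e)) has_derivative
          (\<lambda>h. frechet_derivative w (at (p + of_real t * e)) (of_real h * e))) (at t)"
        by (simp add: o_def)
      moreover have "frechet_derivative w (at (p + of_real t * e)) (of_real h * e)
          = pd [e] w (p + of_real t * e) * h" for h
        using linear_cmul[OF has_derivative_linear[OF D], of h e]
        by (simp add: scaleR_conv_of_real mult.commute)
      ultimately show ?thesis by (simp only: has_field_derivative_def)
    qed
    show ?thesis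
    proof (rule second_derivative_nonneg_at_min[where f = "\<lambda>t. u (p + of_real t * e)"
          and d = "r / (cmod e + 1)" and f' = "\<lambda>t. pd [e] u (p + of_real t * e)"])
      show "0 < r / (cmod e + 1)" using r by (simp add: add_nonneg_pos)
      show "DERIV (\<lambda>t. u (p + of_real t * e)) t :> pd [e] u (p + of_real t * e)"
        if "\<bar>t\<bar> < r / (cmod e + 1)" for t
        using line inS[OF that] assms(2) unfolding twice_diff_on_def by blast
      show "DERIV (\<lambda>t. pd [e] u (p + of_real t * e)) 0 :> pd [e, e] u p"
        using line[of "pd [e] u" 0] assms(2,3) unfolding twice_diff_on_def by simp
      show "u (p + of_real 0 * e) \<le> u (p + of_real t * e)"
        if "\<bar>t\<bar> < r / (cmod e + 1)" for t
        using min inS[OF that] by simp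
    qed
  qed
  then show ?thesis unfolding lap_def by (simp add: add_nonneg_nonneg)
qed

text \<open>The barrier for the strong minimum principle: away from \<open>a\<close>, a large
  \<alpha> makes the factor in front of \<open>G z\<close> as large as desired.\<close>

lemma
  fixes \<alpha> :: real and a :: complex
  defines "G \<equiv> \<lambda>z. exp (- \<alpha> * ((z - a) \<bullet> (z - a)))"
  shows twice_diff_on_gaussian: "twice_diff_on S G"
    and lap_gaussian: "lap G z = (\<alpha>\<^sup>2 * (cmod (z - a))\<^sup>2 - \<alpha>) * G z"
proof -
  have d: "(G has_derivative (\<lambda>h. - 2 * \<alpha> * ((z - a) \<bullet> h) * G z)) (at z)" for z
    unfolding G_def by (auto intro!: derivative_eq_intros simp: inner_commute algebra_simps)
  have 1: "pd [e] G = (\<lambda>z. - 2 * \<alpha> * ((z - a) \<bullet> e) * G z)" for e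
    using frechet_derivative_at[OF d, symmetric] by auto
  have d2: "(pd [e] G has_derivative
      (\<lambda>h. (- 2 * \<alpha> * (h \<bullet> e) + 4 * \<alpha>\<^sup>2 * ((z - a) \<bullet> e) * ((z - a) \<bullet> h)) * G z)) (at z)"
    for z e
    unfolding 1
    by (auto intro!: derivative_eq_intros d simp: algebra_simps power2_eq_square)
  show "twice_diff_on S G"
    unfolding twice_diff_on_def differentiable_def using d d2 by blast
  have 2: "pd [e, e] G z = (- 2 * \<alpha> * (e \<bullet> e) + 4 * \<alpha>\<^sup>2 * ((z - a) \<bullet> e)\<^sup>2) * G z" for e
    using frechet_derivative_at[OF d2[of e z], symmetric]
    by (simp add: power2_eq_square algebra_simps)
  show "lap G z = (\<alpha>\<^sup>2 * (cmod (z - a))\<^sup>2 - \<alpha>) * G z"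
    unfolding lap_def 2
    by (simp add: inner_complex_def cmod_power2 field_simps)
qed

text \<open>On an annulus around \<open>a\<close> the Gaussian \<open>G\<close> below satisfies \<open>lap G > K * G\<close> once its exponent is
  large; comparing \<open>u\<close> with a small multiple of \<open>G - c\<close>, where \<open>c\<close> is the value of \<open>G\<close> on the outer
  circle, spreads positivity from \<open>a\<close> to the whole ball.\<close>

lemma positive_at_center_imp_positive_on_ball:
  assumes "open S" "twice_diff_on S u" "cball a R \<subseteq> S"
    and nonneg: "\<And>z. z \<in> cball a R \<Longrightarrow> u z \<ge> 0"
    and lap: "\<And>z. z \<in> ball a R \<Longrightarrow> lap u z \<le> K * u z"
    and "K \<ge> 0" "u a > 0" "z \<in> ball a R"
  shows "u z > 0"
proof -
  have "R > 0" using assms(8) by (simp add: le_less_trans[OF zero_le_dist])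
  have cont: "continuous_on S u" using assms twice_diff_on_imp_continuous_on by blast
  have "isCont u a" using cont assms(1,3) \<open>R > 0\<close> continuous_on_eq_continuous_at
    by (metis centre_in_cball less_imp_le subsetD)
  then obtain r where r: "r > 0" "\<And>z. dist z a < r \<Longrightarrow> dist (u z) (u a) < u a / 2"
    using \<open>u a > 0\<close> unfolding continuous_at_eps_delta by (meson half_gt_zero)
  define \<rho> where "\<rho> = min r R / 2"
  have \<rho>: "0 < \<rho>" "\<rho> < r" "\<rho> < R" using r \<open>R > 0\<close> by (auto simp: \<rho>_def)
  \<comment> \<open>By continuity, \<epsilon> is a strict lower bound for \<open>u\<close> on the
    closed disc of radius \<rho>.\<close>
  define \<epsilon> where "\<epsilon> = u a / 2"
  have \<epsilon>: "\<epsilon> > 0" using assms by (simp add: \<epsilon>_def)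
  have inner: "u z > \<epsilon>" if "cmod (z - a) \<le> \<rho>" for z
    using r(2)[of z] that \<rho> unfolding \<epsilon>_def dist_norm real_norm_def by linarith
  \<comment> \<open>Chosen so that \<open>\<alpha> * \<rho>\<^sup>2 - 1 \<ge> K + 1\<close>;
    together with \<open>\<alpha> \<ge> 1\<close> this yields \<open>lap G > K * G\<close> wherever
    the distance to \<open>a\<close> is at least \<rho>.\<close>
  define \<alpha> where "\<alpha> = (K + 2) / \<rho>\<^sup>2 + 1"
  have \<alpha>1: "\<alpha> \<ge> 1" using \<rho> \<open>K \<ge> 0\<close> by (simp add: \<alpha>_def)
  have "\<alpha> * \<rho>\<^sup>2 = K + 2 + \<rho>\<^sup>2" using \<rho> by (simp add: \<alpha>_def field_simps)
  then have \<alpha>2: "\<alpha> * \<rho>\<^sup>2 - 1 \<ge> K + 1" by simp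
  have \<alpha>: "\<alpha>\<^sup>2 * s - \<alpha> > K" if "s \<ge> \<rho>\<^sup>2" for s
  proof -
    have "\<alpha> * s \<ge> \<alpha> * \<rho>\<^sup>2" using that \<alpha>1 by (intro mult_left_mono) auto
    then have "1 * (K + 1) \<le> \<alpha> * (\<alpha> * s - 1)"
      using \<alpha>1 \<alpha>2 \<open>K \<ge> 0\<close> by (intro mult_mono) linarith+
    then show ?thesis by (simp add: algebra_simps power2_eq_square)
  qed
  define G where "G = (\<lambda>z. exp (- \<alpha> * ((z - a) \<bullet> (z - a))))"
  have G: "G z = exp (- \<alpha> * (cmod (z - a))\<^sup>2)" for z
    by (simp add: G_def power2_norm_eq_inner)
  define c where "c = exp (- \<alpha> * R\<^sup>2)"
  \<comment> \<open>This is \<open>u - \<epsilon> * (G - c)\<close>. It equals \<open>u\<close> on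
    the outer circle, and it is positive on the inner disc because \<open>G \<le> 1\<close> and
    \<open>u > \<epsilon>\<close> there.\<close>
  define w where "w = (\<lambda>z. 1 * u z + (- \<epsilon>) * G z + \<epsilon> * c)"
  have tG: "twice_diff_on S G" unfolding G_def by (rule twice_diff_on_gaussian)
  have tw: "twice_diff_on S w" unfolding w_def
    using twice_diff_on_linear_combination[OF assms(1,2) tG] .
  define N where "N = cball a R - ball a \<rho>"
  have "compact N" unfolding N_def by (intro compact_diff) auto
  have outer: "w z \<ge> 0" if "z \<in> N" for z
  proof -
    obtain p where p: "p \<in> N" "\<And>z. z \<in> N \<Longrightarrow> w p \<le> w z"
    proof -
      have "continuous_on N w"
        using assms(3)
        by (intro continuous_on_subset[OF twice_diff_on_imp_continuous_on[OF tw]]) (auto simp: N_def)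
      then show ?thesis using continuous_attains_inf[OF \<open>compact N\<close>] that \<open>z \<in> N\<close> by blast
    qed
    have "w p \<ge> 0"
    proof (rule ccontr)
      assume neg: "\<not> w p \<ge> 0"
      have "cmod (p - a) \<noteq> R"
        using neg nonneg[of p] p(1) by (auto simp: w_def G c_def N_def)
      moreover have "\<not> cmod (p - a) \<le> \<rho>"
      proof
        assume "cmod (p - a) \<le> \<rho>"
        then have "u p > \<epsilon>" using inner by simp
        moreover have "\<epsilon> * G p \<le> \<epsilon> * 1" using \<epsilon> \<alpha>1 by (intro mult_left_mono) (auto simp: G)
        moreover have "\<epsilon> * c > 0" using \<epsilon> by (simp add: c_def)
        ultimately show False using neg by (simp add: w_def)
      qed
      \<comment> \<open>A negative minimum is thus interior to the annulus, where
        \<open>0 \<le> lap w p < K * (u p - \<epsilon> * G p)\<close>. But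
        \<open>u p - \<epsilon> * G p = w p - \<epsilon> * c\<close> is negative.\<close>
      ultimately have pO: "p \<in> ball a R - cball a \<rho>"
        using p(1) by (auto simp: N_def dist_norm norm_minus_commute)
      have "lap w p \<ge> 0"
        using pO p(2) assms(3)
        by (intro lap_nonneg_at_min[of "ball a R - cball a \<rho>"] twice_diff_on_subset[OF tw])
          (auto simp: N_def)
      moreover have "lap w p = 1 * lap u p + (- \<epsilon>) * lap G p"
        unfolding w_def using pO assms(3)
        by (intro lap_linear_combination[OF assms(1,2) tG]) auto
      moreover have "lap u p \<le> K * u p" using lap pO by auto
      moreover have "\<epsilon> * lap G p > \<epsilon> * (K * G p)"
      proof -
        have "\<rho>\<^sup>2 \<le> (cmod (p - a))\<^sup>2"
          using pO \<rho> by (intro power_mono) (auto simp: dist_norm norm_minus_commute)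
        from \<alpha>[OF this] have "lap G p > K * G p"
          unfolding G_def lap_gaussian by (intro mult_strict_right_mono) auto
        then show ?thesis using \<epsilon> by simp
      qed
      ultimately have "0 < K * (u p - \<epsilon> * G p)" by (simp add: algebra_simps)
      moreover have "u p - \<epsilon> * G p \<le> 0"
      proof -
        have "\<epsilon> * c > 0" using \<epsilon> by (simp add: c_def)
        then show ?thesis using neg by (simp add: w_def)
      qed
      ultimately show False using \<open>K \<ge> 0\<close> by (meson mult_nonneg_nonpos not_le)
    qed
    then show ?thesis using p(2)[OF that] by simp
  qed
  show ?thesis
  proof (cases "cmod (z - a) \<le> \<rho>")
    case True
    then show ?thesis using inner \<epsilon> by force
  next
    case False
    then have "w z \<ge> 0" using outer assms(8)
      by (auto simp: N_def dist_norm norm_minus_commute)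
    moreover have "G z > c"
    proof -
      have "(cmod (z - a))\<^sup>2 < R\<^sup>2" using assms(8)
        by (intro power_strict_mono) (auto simp: dist_norm norm_minus_commute)
      then show ?thesis using \<alpha>1 by (simp add: G c_def)
    qed
    then have "\<epsilon> * G z > \<epsilon> * c" using \<epsilon> by simp
    ultimately show ?thesis by (simp add: w_def)
  qed
qed

text \<open>The roles of the points are exchanged: were \<open>u\<close> positive at
  \<open>z\<close>, positivity would spread from \<open>z\<close> over the ball of radius
  \<open>R\<close>, which contains \<open>a\<close>. The doubled radius keeps that ball inside the
  given one.\<close>

lemma zero_imp_zero_on_ball:
  assumes "open S" "twice_diff_on S u" "cball a (2 * R) \<subseteq> S"
    and nonneg: "\<And>z. z \<in> S \<Longrightarrow> u z \<ge> 0"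
    and lap: "\<And>z. z \<in> cball a (2 * R) \<Longrightarrow> lap u z \<le> K * u z"
    and "K \<ge> 0" "u a = 0" "z \<in> ball a R"
  shows "u z = 0"
proof (rule ccontr)
  assume "u z \<noteq> 0"
  have z: "dist a z < R" using assms(8) by simp
  have sub: "cball z R \<subseteq> cball a (2 * R)"
  proof
    fix x assume "x \<in> cball z R"
    then show "x \<in> cball a (2 * R)" using z dist_triangle[of a x z] by simp
  qed
  have "dist a z \<ge> 0" by simp
  with z have "z \<in> cball a (2 * R)" unfolding mem_cball by linarith
  then have "u z > 0" using nonneg[of z] \<open>u z \<noteq> 0\<close> assms(3) by force
  have "u a > 0"
  proof (rule positive_at_center_imp_positive_on_ball[where a = z and R = R and S = S and K = K])
    show "cball z R \<subseteq> S" using sub assms(3) by blast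
    show "u x \<ge> 0" if "x \<in> cball z R" for x using that sub assms(3) nonneg by blast
    show "lap u x \<le> K * u x" if "x \<in> ball z R" for x
      using that sub lap[of x] ball_subset_cball by blast
    show "a \<in> ball z R" using z by (simp add: dist_commute)
  qed (use assms \<open>u z > 0\<close> in auto)
  then show False using assms by simp
qed

section \<open>Minimum principles on a closed Riemann surface\<close>

definition surface_fun :: "'a chart set \<Rightarrow> 'a sect \<Rightarrow> bool" where
  "surface_fun A W \<longleftrightarrow>
     (\<forall>c\<in>A. \<forall>d\<in>A. \<forall>p\<in>fst c \<inter> fst d. W c p = W d p) \<and>
     (\<forall>c\<in>A. twice_diff_on (snd c ` fst c) (loc W c))"

lemma holomorphic_atlasD:
  assumes "holomorphic_atlas A" "c \<in> A"
  shows "open (fst c)" "open (snd c ` fst c)" "continuous_on (fst c) (snd c)"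
    "\<And>p. p \<in> fst c \<Longrightarrow> chart_inv c (snd c p) = p"
  using assms unfolding holomorphic_atlas_def homeomorphism_def by blast+

lemma loc_chart:
  "holomorphic_atlas A \<Longrightarrow> c \<in> A \<Longrightarrow> p \<in> fst c \<Longrightarrow> loc W c (snd c p) = W c p"
  by (simp add: loc_def holomorphic_atlasD(4))

text \<open>Compactness and connectedness concern the topology of \<open>'a\<close>, so the
  coefficients in the charts are glued to one continuous function on that type.\<close>

lemma surface_fun_globalE:
  fixes A :: "('a::t2_space) chart set"
  assumes "holomorphic_atlas A" "surface_fun A W"
  obtains f where "continuous_on UNIV f" "\<And>c p. c \<in> A \<Longrightarrow> p \<in> fst c \<Longrightarrow> W c p = f p"
proof -
  \<comment> \<open>The chosen chart is immaterial, since \<open>W\<close> takes the same value in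
    all charts around \<open>p\<close>.\<close>
  define f where "f p = W (SOME c. c \<in> A \<and> p \<in> fst c) p" for p
  have f: "W c p = f p" if "c \<in> A" "p \<in> fst c" for c p
  proof -
    have "(SOME c. c \<in> A \<and> p \<in> fst c) \<in> A \<and> p \<in> fst (SOME c. c \<in> A \<and> p \<in> fst c)"
      by (rule someI[of _ c]) (use that in simp)
    then show ?thesis using that assms(2) unfolding surface_fun_def f_def by blast
  qed
  have "continuous_on (fst c) f" if "c \<in> A" for c
  proof -
    have "continuous_on (snd c ` fst c) (loc W c)"
      using assms(2) that twice_diff_on_imp_continuous_on unfolding surface_fun_def by blast
    then have "continuous_on (fst c) (\<lambda>p. loc W c (snd c p))"
      using continuous_on_compose2 holomorphic_atlasD(3)[OF assms(1) that] by blast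
    then show ?thesis
      by (rule continuous_on_eq) (simp add: loc_chart[OF assms(1) that] f[OF that])
  qed
  then have "continuous_on (\<Union>c\<in>A. fst c) f"
    by (intro continuous_on_open_UN) (auto simp: holomorphic_atlasD(1)[OF assms(1)])
  then have "continuous_on UNIV f" using assms(1) unfolding holomorphic_atlas_def by simp
  with f show ?thesis using that by blast
qed

lemma surface_fun_minimumE:
  fixes A :: "('a::t2_space) chart set"
  assumes surf: "closed_riemann_surface A" and W: "surface_fun A W"
  obtains c p where "c \<in> A" "p \<in> fst c" "lap (loc W c) (snd c p) \<ge> 0"
    "\<And>d q. d \<in> A \<Longrightarrow> q \<in> fst d \<Longrightarrow> W c p \<le> W d q"
proof -
  have atl: "holomorphic_atlas A" and comp: "compact (UNIV :: 'a set)"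
    using surf unfolding closed_riemann_surface_def by auto
  obtain f where f: "continuous_on UNIV f" "\<And>c p. c \<in> A \<Longrightarrow> p \<in> fst c \<Longrightarrow> W c p = f p"
    using surface_fun_globalE[OF atl W] by metis
  obtain p where p: "\<And>q. f p \<le> f q"
    using continuous_attains_inf[OF comp _ f(1)] by auto
  obtain c where c: "c \<in> A" "p \<in> fst c"
    using atl unfolding holomorphic_atlas_def by blast
  have "lap (loc W c) (snd c p) \<ge> 0"
  proof (rule lap_nonneg_at_min)
    show "open (snd c ` fst c)" using holomorphic_atlasD(2)[OF atl c(1)] .
    show "twice_diff_on (snd c ` fst c) (loc W c)" using W c unfolding surface_fun_def by blast
    show "loc W c (snd c p) \<le> loc W c z" if "z \<in> snd c ` fst c" for z
      using that p c by (auto simp: loc_chart[OF atl c(1)] f(2))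
  qed (use c in simp)
  then show ?thesis using that c p f(2) by auto
qed

text \<open>The zero set is closed by continuity and open by the planar principle, hence everything
  by connectedness. \<open>B\<close> may depend on the chart, because the Laplacian of a function
  does.\<close>

lemma surface_strong_minimum_principle:
  fixes A :: "('a::t2_space) chart set"
  assumes surf: "closed_riemann_surface A" and W: "surface_fun A W"
    and nonneg: "\<And>c p. c \<in> A \<Longrightarrow> p \<in> fst c \<Longrightarrow> W c p \<ge> 0"
    and B: "\<And>c. c \<in> A \<Longrightarrow> continuous_on (snd c ` fst c) (loc B c)"
    and lap: "\<And>c p. c \<in> A \<Longrightarrow> p \<in> fst c \<Longrightarrow> lap (loc W c) (snd c p) \<le> B c p * W c p"
    and zero: "c0 \<in> A" "p0 \<in> fst c0" "W c0 p0 = 0"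
    and "c \<in> A" "p \<in> fst c"
  shows "W c p = 0"
proof -
  have atl: "holomorphic_atlas A" and conn: "connected (UNIV :: 'a set)"
    using surf unfolding closed_riemann_surface_def by auto
  obtain f where f: "continuous_on UNIV f" "\<And>c p. c \<in> A \<Longrightarrow> p \<in> fst c \<Longrightarrow> W c p = f p"
    using surface_fun_globalE[OF atl W] by metis
  define Z where "Z = {p. f p = 0}"
  have "closed Z"
    unfolding Z_def using f(1) by (intro closed_Collect_eq) auto
  moreover have "open Z"
  proof (rule Topological_Spaces.openI)
    fix x assume "x \<in> Z"
    obtain c where c: "c \<in> A" "x \<in> fst c"
      using atl unfolding holomorphic_atlas_def by blast
    let ?S = "snd c ` fst c"
    note chart = holomorphic_atlasD[OF atl c(1)] and l = loc_chart[OF atl c(1)]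
    obtain r where r: "r > 0" "cball (snd c x) r \<subseteq> ?S"
      using chart(2) c(2) open_contains_cball by (metis image_eqI)
    \<comment> \<open>On a compact disc \<open>B\<close> is at most a constant \<open>K\<close>, and
      \<open>W \<ge> 0\<close> allows \<open>B\<close> to be replaced by \<open>K\<close>.\<close>
    have "bounded (loc B c ` cball (snd c x) r)"
      using B[OF c(1)] r(2)
      by (intro compact_imp_bounded compact_continuous_image) (auto intro: continuous_on_subset)
    then obtain K where K: "K > 0" "\<And>z. z \<in> cball (snd c x) r \<Longrightarrow> \<bar>loc B c z\<bar> \<le> K"
      unfolding bounded_pos by auto
    have u0: "loc W c z = 0" if "z \<in> ball (snd c x) (r / 2)" for z
    proof (rule zero_imp_zero_on_ball[where S = ?S and a = "snd c x" and R = "r / 2" and K = K])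
      show "twice_diff_on ?S (loc W c)" using W c unfolding surface_fun_def by blast
      show "loc W c z \<ge> 0" if "z \<in> ?S" for z using that nonneg[OF c(1)] by (auto simp: l)
      show "lap (loc W c) z \<le> K * loc W c z" if "z \<in> cball (snd c x) (2 * (r / 2))" for z
      proof -
        have "z \<in> ?S" using that r(2) by auto
        then obtain q where q: "q \<in> fst c" "z = snd c q" by blast
        have "B c q \<le> K" using K(2)[of z] that q by (auto simp: l)
        then have "B c q * W c q \<le> K * W c q"
          using nonneg[OF c(1) q(1)] by (rule mult_right_mono)
        then show ?thesis using lap[OF c(1) q(1)] by (simp add: q l)
      qed
      show "loc W c (snd c x) = 0" using \<open>x \<in> Z\<close> c by (simp add: l f Z_def)
    qed (use chart r K that in auto)
    define U where "U = fst c \<inter> snd c -` ball (snd c x) (r / 2)"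
    have "open U" unfolding U_def
      using continuous_open_preimage[OF chart(3,1) open_ball] .
    moreover have "x \<in> U" using c r by (simp add: U_def)
    moreover have "U \<subseteq> Z"
    proof
      fix q assume "q \<in> U"
      then show "q \<in> Z" using u0[of "snd c q"] c by (auto simp: U_def Z_def l f)
    qed
    ultimately show "\<exists>T. open T \<and> x \<in> T \<and> T \<subseteq> Z" by blast
  qed
  moreover have "p0 \<in> Z" using zero f by (simp add: Z_def)
  ultimately have "Z = UNIV" using conn connected_clopen[of "UNIV::'a set"] by auto
  then show ?thesis using f assms by (auto simp: Z_def)
qed

section \<open>The Toda chain\<close>

definition fuchsian_weight :: "nat \<Rightarrow> nat \<Rightarrow> real" where
  "fuchsian_weight n k = real k * (real n - real k) / 2"

lemma fuchsian_weight_pos: "k \<in> {1..n div 2} \<Longrightarrow> fuchsian_weight n k > 0"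
  by (auto simp: fuchsian_weight_def)

text \<open>The weight is a quadratic in \<open>k\<close> with leading coefficient -1/2. Since
  \<open>ln g0\<close> has Laplacian \<open>g0\<close>, the multiples of \<open>g0\<close> by these
  weights solve the chain with \<open>E = 0\<close>.\<close>

lemma fuchsian_weight_second_difference:
  "k \<ge> 1 \<Longrightarrow>
     2 * fuchsian_weight n k - fuchsian_weight n (k - 1) - fuchsian_weight n (Suc k) = 1"
  by (cases k) (auto simp: fuchsian_weight_def field_simps)

text \<open>The weights are symmetric under \<open>k \<mapsto> n - k\<close>, which sends
  \<open>m + 1\<close> to \<open>m - 1\<close> for \<open>n = 2 * m\<close> and to \<open>m\<close>
  for \<open>n = 2 * m + 1\<close>.\<close>

lemma fuchsian_weight_reflect:
  assumes "n \<ge> 3"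
  shows "fuchsian_weight n (Suc (n div 2)) =
    (if even n then fuchsian_weight n (n div 2 - 1) else fuchsian_weight n (n div 2))"
proof (cases "even n")
  case True
  then obtain m where m: "n = 2 * m" by blast
  with assms obtain l where "m = Suc l" by (cases m) auto
  with m show ?thesis by (simp add: fuchsian_weight_def field_simps)
next
  case False
  then obtain m where m: "n = 2 * m + 1" by (metis oddE)
  then show ?thesis by (simp add: fuchsian_weight_def field_simps)
qed

lemma twice_diff_on_ln_metric_sect:
  assumes "holomorphic_atlas A" "metric_sect A s F" "c \<in> A"
  shows "twice_diff_on (snd c ` fst c) (ln \<circ> loc F c)"
proof (rule twice_diff_on_ln[OF holomorphic_atlasD(2)[OF assms(1,3)]])
  show "twice_diff_on (snd c ` fst c) (loc F c)"
    using assms unfolding metric_sect_def by (blast intro: smooth_on_imp_twice_diff_on)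
  have "F c p > 0" if "p \<in> fst c" for p
    using assms that unfolding metric_sect_def by blast
  then show "loc F c z > 0" if "z \<in> snd c ` fst c" for z
    using that by (auto simp: loc_chart[OF assms(1,3)])
qed

text \<open>\<open>E k\<close> collects the terms of the equation that contain the holomorphic differential.\<close>

locale toda_chain =
  fixes A :: "('a::t2_space) chart set" and g0 :: "'a sect" and n :: nat
    and T E :: "nat \<Rightarrow> 'a sect"
  assumes surf: "closed_riemann_surface A" and hyp: "hyperbolic_metric A g0" and n_ge_3: "n \<ge> 3"
    and T_0: "T 0 c p = 0"
    and T_reflect: "T (Suc (n div 2)) c p =
      (if even n then T (n div 2 - 1) c p else T (n div 2) c p)"
    and T_pos: "k \<in> {1..n div 2} \<Longrightarrow> c \<in> A \<Longrightarrow> p \<in> fst c \<Longrightarrow> T k c p > 0"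
    and T_transition: "k \<in> {1..n div 2} \<Longrightarrow> c \<in> A \<Longrightarrow> d \<in> A \<Longrightarrow> p \<in> fst c \<inter> fst d \<Longrightarrow>
      T k c p = T k d p * cmod (deriv (transition c d) (snd c p)) powr 2"
    and T_diff: "k \<in> {1..n div 2} \<Longrightarrow> c \<in> A \<Longrightarrow>
      twice_diff_on (snd c ` fst c) (ln \<circ> loc (T k) c)"
    and E_nonneg: "k \<in> {1..n div 2} \<Longrightarrow> c \<in> A \<Longrightarrow> p \<in> fst c \<Longrightarrow> E k c p \<ge> 0"
    and toda: "k \<in> {1..n div 2} \<Longrightarrow> c \<in> A \<Longrightarrow> p \<in> fst c \<Longrightarrow>
      lap (ln \<circ> loc (T k) c) (snd c p) =
        2 * T k c p - T (k - 1) c p - T (Suc k) c p - E k c p"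
begin

section \<open>Comparison of the chain with the hyperbolic metric\<close>

lemma atlas: "holomorphic_atlas A"
  using surf unfolding closed_riemann_surface_def by simp

lemma g0_pos: "c \<in> A \<Longrightarrow> p \<in> fst c \<Longrightarrow> g0 c p > 0"
  using hyp unfolding hyperbolic_metric_def metric_sect_def by blast

lemma g0_diff: "c \<in> A \<Longrightarrow> twice_diff_on (snd c ` fst c) (ln \<circ> loc g0 c)"
  using hyp twice_diff_on_ln_metric_sect[OF atlas] unfolding hyperbolic_metric_def by blast

text \<open>The logarithm of the ratio of \<open>T k\<close> to its Fuchsian value. Separate
  logarithms make \<open>loc (W k) c\<close> a linear combination to which the rules for
  \<open>lap\<close> apply.\<close>

definition W :: "nat \<Rightarrow> 'a sect" where
  "W k c p = ln (T k c p) - ln (g0 c p) - ln (fuchsian_weight n k)"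

lemma exp_W:
  assumes "k \<in> {1..n div 2}" "c \<in> A" "p \<in> fst c"
  shows "T k c p = fuchsian_weight n k * (g0 c p * exp (W k c p))"
  using T_pos[OF assms] g0_pos[OF assms(2,3)] fuchsian_weight_pos[OF assms(1)]
  by (simp add: W_def exp_diff)

lemma loc_W: "loc (W k) c =
    (\<lambda>z. 1 * (ln \<circ> loc (T k) c) z + (- 1) * (ln \<circ> loc g0 c) z + (- ln (fuchsian_weight n k)))"
  by (auto simp: loc_def W_def)

lemma lap_W:
  assumes "k \<in> {1..n div 2}" "c \<in> A" "p \<in> fst c"
  shows "lap (loc (W k) c) (snd c p) =
    2 * T k c p - T (k - 1) c p - T (Suc k) c p - E k c p - g0 c p"
proof -
  have "lap (ln \<circ> loc g0 c) (snd c p) = g0 c p"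
    using hyp assms unfolding hyperbolic_metric_def by blast
  moreover have "lap (loc (W k) c) (snd c p) =
      1 * lap (ln \<circ> loc (T k) c) (snd c p) + (- 1) * lap (ln \<circ> loc g0 c) (snd c p)"
    unfolding loc_W using assms
    by (intro lap_linear_combination[OF holomorphic_atlasD(2)[OF atlas] T_diff g0_diff]) auto
  ultimately show ?thesis using toda[OF assms] by simp
qed

text \<open>Both \<open>T k\<close> and \<open>g0\<close> acquire the same factor under a change of
  chart, and it cancels in the difference of logarithms.\<close>

lemma surface_fun_W:
  assumes k: "k \<in> {1..n div 2}"
  shows "surface_fun A (W k)"
  unfolding surface_fun_def
proof (intro conjI ballI)
  fix c d p assume cd: "c \<in> A" "d \<in> A" "p \<in> fst c \<inter> fst d"
  define D where "D = cmod (deriv (transition c d) (snd c p)) powr 2"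
  have "T k c p = T k d p * D"
    using T_transition[OF k cd] by (simp add: D_def)
  moreover have "g0 c p = g0 d p * cmod (deriv (transition c d) (snd c p)) powr (2 * 1)"
    using hyp cd unfolding hyperbolic_metric_def metric_sect_def by blast
  then have "g0 c p = g0 d p * D" by (simp add: D_def)
  moreover have "T k d p > 0" "g0 d p > 0" "T k c p > 0"
    using cd T_pos[OF k] g0_pos by blast+
  \<comment> \<open>Read off from the positivity of \<open>T k\<close> in both charts, which avoids
    showing that the transition map has nonzero derivative.\<close>
  moreover have "D > 0"
    using calculation zero_less_mult_pos[of "T k d p" D] by simp
  ultimately show "W k c p = W k d p" by (simp add: W_def ln_mult)
next
  fix c assume "c \<in> A"
  then show "twice_diff_on (snd c ` fst c) (loc (W k) c)"
    unfolding loc_W using k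
    by (intro twice_diff_on_linear_combination[OF holomorphic_atlasD(2)[OF atlas] T_diff g0_diff])
qed

text \<open>The bounds extend to index 0, where both sides vanish, and by reflection to index
  \<open>n div 2 + 1\<close>. \<open>X\<close> stays free because it is used both with
  \<open>g0\<close> times a constant and with \<open>g0\<close> itself.\<close>

lemma neighbour_bound:
  assumes "k \<in> {1..n div 2}" "\<And>j. j \<in> {1..n div 2} \<Longrightarrow> T j c p \<ge> fuchsian_weight n j * X"
  shows "T (k - 1) c p + T (Suc k) c p \<ge> (2 * fuchsian_weight n k - 1) * X"
proof -
  have le: "T j c p \<ge> fuchsian_weight n j * X" if "j \<le> n div 2" for j
    using that assms(2)[of j] T_0[of c p] by (cases "j = 0") (auto simp: fuchsian_weight_def)
  have "T (Suc k) c p \<ge> fuchsian_weight n (Suc k) * X"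
  proof (cases "k = n div 2")
    case True
    then show ?thesis
      using le[of "n div 2 - 1"] le[of "n div 2"] T_reflect[of c p]
        fuchsian_weight_reflect[OF n_ge_3] by simp
  next
    case False
    then show ?thesis using assms(1) le[of "Suc k"] by simp
  qed
  moreover have "T (k - 1) c p \<ge> fuchsian_weight n (k - 1) * X"
    using assms(1) by (intro le) auto
  moreover have "2 * fuchsian_weight n k - 1 = fuchsian_weight n (k - 1) + fuchsian_weight n (Suc k)"
    using fuchsian_weight_second_difference[of k n] assms(1) by simp
  ultimately show ?thesis by (simp add: distrib_right)
qed

lemma W_nonneg:
  assumes j: "j \<in> {1..n div 2}" "d \<in> A" "q \<in> fst d"
  shows "W j d q \<ge> 0"
proof -
  have "\<exists>c p. c \<in> A \<and> p \<in> fst c \<and> lap (loc (W k) c) (snd c p) \<ge> 0 \<and>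
      (\<forall>d\<in>A. \<forall>q\<in>fst d. W k c p \<le> W k d q)" if "k \<in> {1..n div 2}" for k
    using surface_fun_minimumE[OF surf surface_fun_W[OF that]] by metis
  then obtain c p where cp: "\<And>k. k \<in> {1..n div 2} \<Longrightarrow> c k \<in> A \<and> p k \<in> fst (c k) \<and>
      lap (loc (W k) (c k)) (snd (c k) (p k)) \<ge> 0 \<and>
      (\<forall>d\<in>A. \<forall>q\<in>fst d. W k (c k) (p k) \<le> W k d q)"
    by metis
  \<comment> \<open>The smallest of the finitely many minima bounds every \<open>W i\<close>, so it
    also controls the neighbours of \<open>k\<close> in the chain.\<close>
  obtain k where k: "k \<in> {1..n div 2}"
    and kmin: "\<And>i. i \<in> {1..n div 2} \<Longrightarrow> W k (c k) (p k) \<le> W i (c i) (p i)"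
    using ex_is_arg_min_if_finite[of "{1..n div 2}" "\<lambda>i. W i (c i) (p i)"] j(1)
    by (auto simp: is_arg_min_linorder)
  define \<mu> where "\<mu> = W k (c k) (p k)"
  have \<mu>: "\<mu> \<le> W i d q" if "i \<in> {1..n div 2}" "d \<in> A" "q \<in> fst d" for i d q
    using kmin[OF that(1)] cp[OF that(1)] that unfolding \<mu>_def by force
  have ck: "c k \<in> A" "p k \<in> fst (c k)" using cp[OF k] by auto
  define X where "X = g0 (c k) (p k) * exp \<mu>"
  have "T i (c k) (p k) \<ge> fuchsian_weight n i * X" if "i \<in> {1..n div 2}" for i
    unfolding exp_W[OF that ck] X_def
    using \<mu>[OF that ck] fuchsian_weight_pos[OF that] g0_pos[OF ck] by simp
  then have "T (k - 1) (c k) (p k) + T (Suc k) (c k) (p k) \<ge> (2 * fuchsian_weight n k - 1) * X"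
    using neighbour_bound[OF k] by blast
  moreover have "0 \<le> lap (loc (W k) (c k)) (snd (c k) (p k))"
    using cp[OF k] by simp
  moreover have "T k (c k) (p k) = fuchsian_weight n k * X"
    unfolding X_def \<mu>_def using exp_W[OF k ck] .
  \<comment> \<open>The weights cancel and leave \<open>0 \<le> lap (loc (W k) (c k)) (snd (c k) (p
    k)) \<le> X - g0 (c k) (p k)\<close>.\<close>
  ultimately have "g0 (c k) (p k) \<le> X"
    using E_nonneg[OF k ck] by (simp add: lap_W[OF k ck] left_diff_distrib)
  then have "\<mu> \<ge> 0" using g0_pos[OF ck] by (simp add: X_def)
  then show ?thesis using \<mu>[OF j] by simp
qed

lemma fuchsian_lower_bound:
  assumes "k \<in> {1..n div 2}" "c \<in> A" "p \<in> fst c"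
  shows "T k c p \<ge> fuchsian_weight n k * g0 c p"
  unfolding exp_W[OF assms]
  using W_nonneg[OF assms] fuchsian_weight_pos[OF assms(1)] g0_pos[OF assms(2,3)] by simp

text \<open>The lower bounds on the neighbours decouple the chain: \<open>W k\<close> alone
  satisfies a differential inequality, so touching the Fuchsian value at one point propagates at
  this single index.\<close>

lemma fuchsian_rigidity:
  assumes k: "k \<in> {1..n div 2}" and c0: "c0 \<in> A" "p0 \<in> fst c0"
    and eq: "T k c0 p0 = fuchsian_weight n k * g0 c0 p0"
    and c: "c \<in> A" "p \<in> fst c"
  shows "E k c p = 0"
proof -
  have nb: "T (k - 1) c p + T (Suc k) c p \<ge> (2 * fuchsian_weight n k - 1) * g0 c p"
    if "c \<in> A" "p \<in> fst c" for c p
    using neighbour_bound[OF k] fuchsian_lower_bound that by blast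
  have W0: "W k c p = 0" if "c \<in> A" "p \<in> fst c" for c p
  proof (rule surface_strong_minimum_principle[where B = "\<lambda>c p. 2 * T k c p",
        OF surf surface_fun_W[OF k] W_nonneg[OF k] _ _ c0 _ that])
    show "W k c0 p0 = 0"
      using exp_W[OF k c0] eq fuchsian_weight_pos[OF k] g0_pos[OF c0] by simp
  next
    fix c assume c: "c \<in> A"
    have "continuous_on (snd c ` fst c) (\<lambda>z. 2 * exp ((ln \<circ> loc (T k) c) z))"
      by (intro continuous_intros twice_diff_on_imp_continuous_on[OF T_diff[OF k c]])
    then show "continuous_on (snd c ` fst c) (loc (\<lambda>c p. 2 * T k c p) c)"
    proof (rule continuous_on_eq)
      fix z assume "z \<in> snd c ` fst c"
      then obtain q where q: "q \<in> fst c" "z = snd c q" by blast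
      then show "2 * exp ((ln \<circ> loc (T k) c) z) = loc (\<lambda>c p. 2 * T k c p) c z"
        using T_pos[OF k c q(1)] by (simp add: loc_chart[OF atlas c])
    qed
  next
    fix c p assume c: "c \<in> A" "p \<in> fst c"
    let ?w = "W k c p" and ?a = "fuchsian_weight n k"
    \<comment> \<open>The convexity bound turns the estimate in \<open>exp ?w - 1\<close> into one
      linear in \<open>?w\<close>, with coefficient \<open>2 * T k c p\<close>.\<close>
    have "(1 + - ?w) * exp ?w \<le> exp (- ?w) * exp ?w"
      by (intro mult_right_mono exp_ge_add_one_self) simp
    then have "exp ?w - 1 \<le> ?w * exp ?w" by (simp add: algebra_simps flip: exp_add)
    then have "2 * ?a * g0 c p * (exp ?w - 1) \<le> 2 * ?a * g0 c p * (?w * exp ?w)"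
      using fuchsian_weight_pos[OF k] g0_pos[OF c] by (intro mult_left_mono) auto
    moreover have "lap (loc (W k) c) (snd c p) \<le> 2 * ?a * g0 c p * (exp ?w - 1)"
      using nb[OF c] E_nonneg[OF k c] unfolding lap_W[OF k c] exp_W[OF k c]
      by (simp add: algebra_simps)
    ultimately show "lap (loc (W k) c) (snd c p) \<le> 2 * T k c p * ?w"
      unfolding exp_W[OF k c] by (simp add: algebra_simps)
  qed
  have "lap (loc (W k) c) (snd c p) = lap (\<lambda>_. 0) (snd c p)"
  proof (rule lap_cong_open[OF holomorphic_atlasD(2)[OF atlas c(1)]])
    show "loc (W k) c z = 0" if "z \<in> snd c ` fst c" for z
      using that W0[OF c(1)] by (auto simp: loc_chart[OF atlas c(1)])
  qed (use c in simp)
  then have "2 * T k c p - T (k - 1) c p - T (Suc k) c p - E k c p - g0 c p = 0"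
    unfolding lap_W[OF k c] by (simp add: lap_def)
  moreover have "T k c p = fuchsian_weight n k * g0 c p"
    using exp_W[OF k c] W0[OF c] by simp
  \<comment> \<open>With \<open>W k\<close> identically zero, the equation expresses
    \<open>E k\<close> as the Fuchsian lower bound for the two neighbours minus their sum.\<close>
  ultimately have "E k c p \<le> 0" using nb[OF c] by (simp add: algebra_simps)
  then show ?thesis using E_nonneg[OF k c] by simp
qed

end

text \<open>The multiplicity of \<open>T k\<close> in the trace: it is counted again at the mirror
  index \<open>n - k\<close>, except for the middle index of even \<open>n\<close>, which is its own
  mirror.\<close>

definition chain_mult :: "nat \<Rightarrow> nat \<Rightarrow> real" where
  "chain_mult n k = (if even n \<and> k = n div 2 then 1 else 2)"

lemma sum_chain_mult:
  assumes "n div 2 \<ge> 1"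
  shows "(\<Sum>k\<in>{1..n div 2}. chain_mult n k * f k) =
    2 * (\<Sum>k\<in>{1..<n div 2}. f k) + (if even n then f (n div 2) else 2 * f (n div 2))"
proof -
  have "{1..n div 2} = insert (n div 2) {1..<n div 2}" using assms by auto
  then have "(\<Sum>k\<in>{1..n div 2}. chain_mult n k * f k) =
      chain_mult n (n div 2) * f (n div 2) + (\<Sum>k\<in>{1..<n div 2}. chain_mult n k * f k)"
    by simp
  also have "(\<Sum>k\<in>{1..<n div 2}. chain_mult n k * f k) = 2 * (\<Sum>k\<in>{1..<n div 2}. f k)"
    by (simp add: chain_mult_def sum_distrib_left)
  finally show ?thesis by (simp add: chain_mult_def)
qed

lemma sum_fuchsian_weight:
  "(\<Sum>k\<in>{1..<m}. fuchsian_weight n k) = real m * (real m - 1) * (3 * real n - 2 * real m + 1) / 12"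
proof (induction m)
  case (Suc m)
  show ?case
  proof (cases m)
    case (Suc l)
    then have "{1..<Suc m} = insert m {1..<m}" by auto
    then have "(\<Sum>k\<in>{1..<Suc m}. fuchsian_weight n k) =
        fuchsian_weight n m + (\<Sum>k\<in>{1..<m}. fuchsian_weight n k)" by simp
    then show ?thesis unfolding Suc.IH by (simp add: fuchsian_weight_def field_simps)
  qed simp
qed simp

text \<open>By reflection this is the sum of \<open>k * (n - k) / 2\<close> over all
  \<open>k\<close> from 1 to \<open>n - 1\<close>. The factor \<open>2 * n\<close> in the metric
  then produces the Fuchsian constant.\<close>

lemma sum_chain_mult_fuchsian_weight:
  assumes "n \<ge> 3"
  shows "(\<Sum>k\<in>{1..n div 2}. chain_mult n k * fuchsian_weight n k) = (real n ^ 3 - real n) / 12"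
proof -
  have *: "n div 2 \<ge> 1" using assms by simp
  show ?thesis
  proof (cases "even n")
    case True
    then obtain m where m: "n = 2 * m" by blast
    show ?thesis unfolding sum_chain_mult[OF *] sum_fuchsian_weight
      by (simp add: m fuchsian_weight_def field_simps power3_eq_cube)
  next
    case False
    then obtain m where m: "n = 2 * m + 1" by (metis oddE)
    show ?thesis unfolding sum_chain_mult[OF *] sum_fuchsian_weight
      by (simp add: m fuchsian_weight_def field_simps power3_eq_cube)
  qed
qed

context toda_chain
begin

text \<open>\<open>t\<close> is the contribution of the differential. Beyond the Fuchsian value,
  \<open>gf\<close> consists of \<open>t\<close> and the gaps between each \<open>T k\<close> and
  its lower bound, all nonnegative, so equality closes every gap.\<close>

lemma
  assumes c: "c \<in> A" "p \<in> fst c" and "t \<ge> 0"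
    and gf: "gf = 2 * real n * (t + (\<Sum>k\<in>{1..n div 2}. chain_mult n k * T k c p))"
  shows fuchsian_domination: "gf \<ge> (real n ^ 4 - real n ^ 2) / 6 * g0 c p"
    and fuchsian_domination_eq: "gf = (real n ^ 4 - real n ^ 2) / 6 * g0 c p \<Longrightarrow>
      k \<in> {1..n div 2} \<Longrightarrow> T k c p = fuchsian_weight n k * g0 c p"
proof -
  define \<Delta> where "\<Delta> k = chain_mult n k * (T k c p - fuchsian_weight n k * g0 c p)" for k
  have \<Delta>: "\<Delta> k \<ge> 0" if "k \<in> {1..n div 2}" for k
    using fuchsian_lower_bound[OF that c] by (simp add: \<Delta>_def chain_mult_def)
  have "sum \<Delta> {1..n div 2} = (\<Sum>k\<in>{1..n div 2}. chain_mult n k * T k c p) -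
      (\<Sum>k\<in>{1..n div 2}. chain_mult n k * fuchsian_weight n k) * g0 c p"
    by (simp add: \<Delta>_def right_diff_distrib sum_subtractf sum_distrib_right mult.assoc)
  then have "gf = 2 * real n * (t + sum \<Delta> {1..n div 2} + (real n ^ 3 - real n) / 12 * g0 c p)"
    unfolding gf sum_chain_mult_fuchsian_weight[OF n_ge_3] by simp
  then have gf': "gf = 2 * real n * (t + sum \<Delta> {1..n div 2}) +
      (real n ^ 4 - real n ^ 2) / 6 * g0 c p"
    by (simp add: field_simps power4_eq_xxxx power3_eq_cube power2_eq_square)
  have nonneg: "sum \<Delta> {1..n div 2} \<ge> 0" using \<Delta> by (rule sum_nonneg)
  then show "gf \<ge> (real n ^ 4 - real n ^ 2) / 6 * g0 c p"
    unfolding gf' using \<open>t \<ge> 0\<close> by simp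
  assume "gf = (real n ^ 4 - real n ^ 2) / 6 * g0 c p" and k: "k \<in> {1..n div 2}"
  then have "t + sum \<Delta> {1..n div 2} = 0" unfolding gf' using n_ge_3 by simp
  then have "sum \<Delta> {1..n div 2} = 0" using nonneg \<open>t \<ge> 0\<close> by simp
  then have "\<Delta> k = 0" using sum_nonneg_eq_0_iff[of "{1..n div 2}" \<Delta>] \<Delta> k by auto
  then show "T k c p = fuchsian_weight n k * g0 c p"
    by (auto simp: \<Delta>_def chain_mult_def split: if_splits)
qed

end

section \<open>Hitchin's equation as a Toda chain\<close>

text \<open>The value at 0 is zero because the terms with the differential go into \<open>E\<close>.
  Above \<open>n div 2\<close> only the first index occurs in the equations, and there the value is
  the reflected one.\<close>

definition toda_T :: "nat \<Rightarrow> (nat \<Rightarrow> 'a sect) \<Rightarrow> nat \<Rightarrow> 'a sect" where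
  "toda_T n h k c p =
     (if k = 0 then 0
      else if k \<le> n div 2 then Tterm n h k c p
      else if even n then Tterm n h (n div 2 - 1) c p else Tterm n h (n div 2) c p)"

lemma metrics_okD:
  assumes "metrics_ok A n h" "k \<in> {1..n div 2}"
  shows "metric_sect A (- (real n + 1 - 2 * real k) / 2) (h k)"
    "\<And>c p. c \<in> A \<Longrightarrow> p \<in> fst c \<Longrightarrow> h k c p > 0"
    "\<And>c d p. c \<in> A \<Longrightarrow> d \<in> A \<Longrightarrow> p \<in> fst c \<inter> fst d \<Longrightarrow>
      h k c p = h k d p *
        cmod (deriv (transition c d) (snd c p)) powr (- (real n + 1 - 2 * real k))"
proof -
  show *: "metric_sect A (- (real n + 1 - 2 * real k) / 2) (h k)"
    using assms unfolding metrics_ok_def by blast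
  show "h k c p > 0" if "c \<in> A" "p \<in> fst c" for c p
    using * that unfolding metric_sect_def by blast
  show "h k c p = h k d p *
      cmod (deriv (transition c d) (snd c p)) powr (- (real n + 1 - 2 * real k))"
    if "c \<in> A" "d \<in> A" "p \<in> fst c \<inter> fst d" for c d p
  proof -
    have "h k c p = h k d p * cmod (deriv (transition c d) (snd c p)) powr
        (2 * (- (real n + 1 - 2 * real k) / 2))"
      using * that unfolding metric_sect_def by blast
    moreover have "2 * (- (real n + 1 - 2 * real k) / 2) = - (real n + 1 - 2 * real k)"
      by (simp add: field_simps)
    ultimately show ?thesis by (simp only:)
  qed
qed

lemma toda_T_pos:
  assumes "metrics_ok A n h" "k \<in> {1..n div 2}" "c \<in> A" "p \<in> fst c"
  shows "toda_T n h k c p > 0"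
  using assms metrics_okD(2)[OF assms] metrics_okD(2)[OF assms(1) _ assms(3,4), of "k + 1"]
  by (auto simp: toda_T_def Tterm_def)

text \<open>Consecutive metrics have exponents differing by 2. The last one has exponent -1 for even
  \<open>n\<close>, where \<open>h\<close> enters as an inverse square, and -2 for odd
  \<open>n\<close>, where it enters as an inverse.\<close>

lemma toda_T_transition:
  assumes ok: "metrics_ok A n h" and k: "k \<in> {1..n div 2}"
    and cd: "c \<in> A" "d \<in> A" "p \<in> fst c \<inter> fst d"
  shows "toda_T n h k c p = toda_T n h k d p * cmod (deriv (transition c d) (snd c p)) powr 2"
proof -
  define D where "D = cmod (deriv (transition c d) (snd c p))"
  have hk: "h k c p = h k d p * D powr (- (real n + 1 - 2 * real k))"
    unfolding D_def using metrics_okD(3)[OF ok k cd] .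
  show ?thesis
  proof (cases "k < n div 2")
    case True
    then have hk1: "h (k + 1) c p = h (k + 1) d p * D powr (- (real n + 1 - 2 * real (k + 1)))"
      unfolding D_def using metrics_okD(3)[OF ok _ cd, of "k + 1"] by simp
    have "h (k + 1) c p / h k c p = h (k + 1) d p / h k d p *
        (D powr (- (real n + 1 - 2 * real (k + 1))) / D powr (- (real n + 1 - 2 * real k)))"
      unfolding hk hk1 by simp
    also have "D powr (- (real n + 1 - 2 * real (k + 1))) / D powr (- (real n + 1 - 2 * real k))
        = D powr 2"
      by (simp flip: powr_diff)
    finally show ?thesis using True k by (simp add: toda_T_def Tterm_def D_def)
  next
    case False
    then have km: "k = n div 2" using k by simp
    show ?thesis
    proof (cases "even n")
      case True
      then have "h k c p = h k d p * D powr (- 1)"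
        using hk km by (simp add: real_of_nat_div)
      then have "1 / (h k c p)\<^sup>2 = 1 / (h k d p)\<^sup>2 * (D powr 1 * D powr 1)"
        unfolding powr_minus by (simp only: power_mult_distrib power_inverse inverse_mult_distrib
            divide_inverse inverse_inverse_eq power2_eq_square mult_1 mult_ac)
      also have "D powr 1 * D powr 1 = D powr 2"
        using powr_add[of D 1 1] by simp
      finally show ?thesis using True k km by (simp add: toda_T_def Tterm_def D_def)
    next
      case odd: False
      then have "real n = 2 * real (n div 2) + 1"
        by (auto elim: oddE)
      then have "h k c p = h k d p * D powr (- 2)" using hk km by simp
      then have "1 / h k c p = 1 / h k d p * D powr 2"
        unfolding powr_minus by (simp only: inverse_mult_distrib divide_inverse inverse_inverse_eq mult_1)
      then show ?thesis using odd k km by (simp add: toda_T_def Tterm_def D_def)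
    qed
  qed
qed

lemma
  assumes atl: "holomorphic_atlas A" and ok: "metrics_ok A n h" and k: "k \<in> {1..n div 2}"
    and c: "c \<in> A"
  shows twice_diff_on_ln_toda_T: "twice_diff_on (snd c ` fst c) (ln \<circ> loc (toda_T n h k) c)"
    and lap_ln_toda_T: "p \<in> fst c \<Longrightarrow> lap (ln \<circ> loc (toda_T n h k) c) (snd c p) =
      (if k < n div 2
       then lap (ln \<circ> loc (h (k + 1)) c) (snd c p) - lap (ln \<circ> loc (h k) c) (snd c p)
       else (if even n then - 2 else - 1) * lap (ln \<circ> loc (h k) c) (snd c p))"
proof -
  let ?S = "snd c ` fst c"
  note S = holomorphic_atlasD(2)[OF atl c]
  \<comment> \<open>One linear combination of logarithms covers all three shapes of
    \<open>Tterm\<close>. At the last index \<open>j\<close> falls back to \<open>k\<close>, to stay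
    in range, and its coefficient \<open>a\<close> is 0.\<close>
  define j where "j = (if k < n div 2 then k + 1 else k)"
  have j: "j \<in> {1..n div 2}" using k by (auto simp: j_def)
  define a :: real where "a = (if k < n div 2 then 1 else 0)"
  define b :: real where "b = (if k < n div 2 then - 1 else if even n then - 2 else - 1)"
  let ?L = "\<lambda>z. a * (ln \<circ> loc (h j) c) z + b * (ln \<circ> loc (h k) c) z + 0"
  have eq: "(ln \<circ> loc (toda_T n h k) c) z = ?L z" if "z \<in> ?S" for z
  proof -
    from that obtain q where q: "q \<in> fst c" "z = snd c q" by blast
    have "h k c q > 0" "h j c q > 0"
      using metrics_okD(2)[OF ok k c q(1)] metrics_okD(2)[OF ok j c q(1)] .
    then show ?thesis using k
      by (auto simp: q loc_chart[OF atl c] toda_T_def Tterm_def a_def b_def j_def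
          ln_div ln_realpow)
  qed
  note d = twice_diff_on_ln_metric_sect[OF atl metrics_okD(1)[OF ok j] c]
    twice_diff_on_ln_metric_sect[OF atl metrics_okD(1)[OF ok k] c]
  show "twice_diff_on ?S (ln \<circ> loc (toda_T n h k) c)"
    using twice_diff_on_linear_combination[OF S d, of a b 0]
      twice_diff_on_cong_open[OF S, of "ln \<circ> loc (toda_T n h k) c" ?L] eq by blast
  assume p: "p \<in> fst c"
  have "lap (ln \<circ> loc (toda_T n h k) c) (snd c p) = lap ?L (snd c p)"
    by (rule lap_cong_open[OF S eq]) (use p in auto)
  also have "\<dots> = a * lap (ln \<circ> loc (h j) c) (snd c p) + b * lap (ln \<circ> loc (h k) c) (snd c p)"
    by (rule lap_linear_combination[OF S d]) (use p in simp)
  finally show "lap (ln \<circ> loc (toda_T n h k) c) (snd c p) =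
      (if k < n div 2
       then lap (ln \<circ> loc (h (k + 1)) c) (snd c p) - lap (ln \<circ> loc (h k) c) (snd c p)
       else (if even n then - 2 else - 1) * lap (ln \<circ> loc (h k) c) (snd c p))"
    by (simp add: a_def b_def j_def)
qed

section \<open>The chains of the two Higgs fields\<close>

lemma toda_chainI:
  fixes A :: "('a::t2_space) chart set"
  assumes surf: "closed_riemann_surface A" and "hyperbolic_metric A g0" "n \<ge> 3"
    and ok: "metrics_ok A n h"
    and "\<And>k c p. k \<in> {1..n div 2} \<Longrightarrow> c \<in> A \<Longrightarrow> p \<in> fst c \<Longrightarrow> E k c p \<ge> 0"
    and "\<And>k c p. k \<in> {1..n div 2} \<Longrightarrow> c \<in> A \<Longrightarrow> p \<in> fst c \<Longrightarrow>
      lap (ln \<circ> loc (toda_T n h k) c) (snd c p) =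
        2 * toda_T n h k c p - toda_T n h (k - 1) c p - toda_T n h (Suc k) c p - E k c p"
  shows "toda_chain A g0 n (toda_T n h) E"
proof -
  have atl: "holomorphic_atlas A"
    using surf unfolding closed_riemann_surface_def by simp
  show ?thesis
  proof
    show "toda_T n h 0 c p = 0" for c p
      by (simp add: toda_T_def)
    show "toda_T n h (Suc (n div 2)) c p =
        (if even n then toda_T n h (n div 2 - 1) c p else toda_T n h (n div 2) c p)" for c p
      using \<open>n \<ge> 3\<close> by (auto simp: toda_T_def)
  qed (fact assms toda_T_pos[OF ok] toda_T_transition[OF ok] twice_diff_on_ln_toda_T[OF atl ok])+
qed

lemma qn_toda_chain:
  fixes A :: "('a::t2_space) chart set"
  assumes surf: "closed_riemann_surface A" and "hyperbolic_metric A g0" "n \<ge> 3"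
    and sys: "qn_system A n Q h"
  shows "toda_chain A g0 n (toda_T n h)
    (\<lambda>k c p. if k = 1 then (h 1 c p)\<^sup>2 * (cmod (Q c p))\<^sup>2 else 0)" (is "toda_chain _ _ _ _ ?E")
proof (rule toda_chainI[OF assms(1-3)])
  have atl: "holomorphic_atlas A"
    using surf unfolding closed_riemann_surface_def by simp
  show ok: "metrics_ok A n h" using sys unfolding qn_system_def by simp
  fix k c p assume k: "k \<in> {1..n div 2}" and c: "c \<in> A" "p \<in> fst c"
  show "?E k c p \<ge> 0" by simp
  have L: "lap (ln \<circ> loc (h j) c) (snd c p) = toda_T n h (j - 1) c p + ?E j c p - toda_T n h j c p"
    if j: "j \<in> {1..n div 2}" for j
  proof -
    have "lap (ln \<circ> loc (h j) c) (snd c p) + Tterm n h j c p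
        - (if j = 1 then (h 1 c p)^2 * (cmod (Q c p))^2 else Tterm n h (j - 1) c p) = 0"
      using sys c j unfolding qn_system_def by blast
    then show ?thesis using j by (auto simp: toda_T_def)
  qed
  show "lap (ln \<circ> loc (toda_T n h k) c) (snd c p) =
      2 * toda_T n h k c p - toda_T n h (k - 1) c p - toda_T n h (Suc k) c p - ?E k c p"
  proof (cases "k < n div 2")
    case True
    then show ?thesis using k L[of k] L[of "k + 1"] lap_ln_toda_T[OF atl ok k c] by simp
  next
    case False
    then have km: "k = n div 2" using k by simp
    have "toda_T n h (Suc k) c p = (if even n then toda_T n h (k - 1) c p else toda_T n h k c p)"
      using \<open>n \<ge> 3\<close> by (auto simp: km toda_T_def)
    \<comment> \<open>At an even middle index the equation for \<open>h k\<close> is doubled; as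
      this index is not 1, the differential term is not doubled with it.\<close>
    moreover have "even n \<Longrightarrow> k \<noteq> 1" using \<open>n \<ge> 3\<close> km by auto
    ultimately show ?thesis using False L[OF k] lap_ln_toda_T[OF atl ok k c] by simp
  qed
qed

text \<open>The differential enters the equations of \<open>h 1\<close> and \<open>h 2\<close>
  equally, so it cancels in the logarithm of \<open>h 2 / h 1\<close> and survives only at index 2.
  For \<open>n = 4\<close> the last quotient is the inverse square of \<open>h 2\<close>, whence the
  factor 2.\<close>

lemma qn1_toda_chain:
  fixes A :: "('a::t2_space) chart set"
  assumes surf: "closed_riemann_surface A" and hyp: "hyperbolic_metric A g0" and n: "n \<ge> 4"
    and sys: "qn1_system A n Q h"
  shows "toda_chain A g0 n (toda_T n h) (\<lambda>k c p. if k = 2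
    then (if n = 4 then 2 else 1) * (h 1 c p * h 2 c p * (cmod (Q c p))\<^sup>2) else 0)"
    (is "toda_chain _ _ _ _ ?E")
proof (rule toda_chainI[OF surf hyp])
  have atl: "holomorphic_atlas A"
    using surf unfolding closed_riemann_surface_def by simp
  show "n \<ge> 3" using n by simp
  have m: "n div 2 \<ge> 2" using n by auto
  show ok: "metrics_ok A n h" using sys unfolding qn1_system_def by simp
  fix k c p assume k: "k \<in> {1..n div 2}" and c: "c \<in> A" "p \<in> fst c"
  have "h 1 c p > 0" "h 2 c p > 0"
    using metrics_okD(2)[OF ok _ c, of 1] metrics_okD(2)[OF ok _ c, of 2] m by auto
  then show "?E k c p \<ge> 0" by simp
  define t where "t = h 1 c p * h 2 c p * (cmod (Q c p))\<^sup>2"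
  have L: "lap (ln \<circ> loc (h j) c) (snd c p) =
      toda_T n h (j - 1) c p + (if j \<le> 2 then t else 0) - toda_T n h j c p"
    if j: "j \<in> {1..n div 2}" for j
  proof -
    have eqs: "lap (ln \<circ> loc (h 1) c) (snd c p) + Tterm n h 1 c p - t = 0"
      "lap (ln \<circ> loc (h 2) c) (snd c p) + Tterm n h 2 c p - Tterm n h 1 c p - t = 0"
      "\<And>i. i \<in> {3..n div 2} \<Longrightarrow>
        lap (ln \<circ> loc (h i) c) (snd c p) + Tterm n h i c p - Tterm n h (i - 1) c p = 0"
      using sys c unfolding qn1_system_def t_def by blast+
    consider "j = 1" | "j = 2" | "j \<in> {3..n div 2}" using j by force
    then show ?thesis
    proof cases
      case 1
      then show ?thesis using eqs(1) m by (simp add: toda_T_def)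
    next
      case 2
      then show ?thesis using eqs(2) m by (simp add: toda_T_def)
    next
      case 3
      then show ?thesis using eqs(3)[OF 3] by (auto simp: toda_T_def)
    qed
  qed
  have E: "?E k c p = (if k = 2 then (if n = 4 then 2 else 1) * t else 0)"
    by (simp add: t_def)
  show "lap (ln \<circ> loc (toda_T n h k) c) (snd c p) =
      2 * toda_T n h k c p - toda_T n h (k - 1) c p - toda_T n h (Suc k) c p - ?E k c p"
  proof (cases "k < n div 2")
    case True
    then have "n \<noteq> 4 \<or> k \<noteq> 2" by auto
    then show ?thesis unfolding E
      using True k L[of k] L[of "k + 1"] lap_ln_toda_T[OF atl ok k c] by auto
  next
    case False
    then have km: "k = n div 2" using k by simp
    have r: "toda_T n h (Suc k) c p = (if even n then toda_T n h (k - 1) c p else toda_T n h k c p)"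
      using n by (auto simp: km toda_T_def)
    \<comment> \<open>If 2 is the last index, \<open>n\<close> is 4 or 5, and parity decides whether
      the factor 2 occurs.\<close>
    have "k = 2 \<Longrightarrow> n = 4 \<longleftrightarrow> even n" "k \<ge> 2" using km m by auto
    then show ?thesis unfolding E
      using r False L[OF k] lap_ln_toda_T[OF atl ok k c] by (auto split: if_splits)
  qed
qed

lemma gf_bracket_conv_toda_T:
  assumes "n \<ge> 3"
  shows "2 * (\<Sum>k\<in>{1..<n div 2}. h (k+1) c p / h k c p)
      + (if even n then 1 / (h (n div 2) c p)^2 else 2 / h (n div 2) c p) =
    (\<Sum>k\<in>{1..n div 2}. chain_mult n k * toda_T n h k c p)"
proof -
  have 1: "n div 2 \<ge> 1" using assms by simp
  have 2: "(\<Sum>k\<in>{1..<n div 2}. h (k+1) c p / h k c p) = (\<Sum>k\<in>{1..<n div 2}. toda_T n h k c p)"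
    by (intro sum.cong) (auto simp: toda_T_def Tterm_def)
  show ?thesis
    unfolding sum_chain_mult[OF 1] 2 using 1 by (auto simp: toda_T_def Tterm_def)
qed

text \<open>Rigidity is applied at the index where \<open>E\<close> carries the differential, 1 in
  the first case and 2 in the second. As the metrics are positive, vanishing of \<open>E\<close>
  there forces \<open>Q\<close> to vanish.\<close>

theorem theorem1p1:
  fixes A :: "('a::t2_space) chart set" and g0 :: "'a sect"
  assumes "closed_riemann_surface A"
    and "hyperbolic_metric A g0"
  shows
   "(\<forall>n Q h. n \<ge> 3 \<and> hol_diff A n Q \<and> qn_system A n Q h \<longrightarrow>
       (\<forall>c\<in>A. \<forall>p\<in>fst c. gf_qn n Q h c p \<ge> (real n ^ 4 - real n ^ 2) / 6 * g0 c p) \<and>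
       ((\<exists>c\<in>A. \<exists>p\<in>fst c. gf_qn n Q h c p = (real n ^ 4 - real n ^ 2) / 6 * g0 c p)
          \<longrightarrow> (\<forall>c\<in>A. \<forall>p\<in>fst c. Q c p = 0))) \<and>
    (\<forall>n Q h. n \<ge> 4 \<and> hol_diff A (n - 1) Q \<and> qn1_system A n Q h \<longrightarrow>
       (\<forall>c\<in>A. \<forall>p\<in>fst c. gf_qn1 n Q h c p \<ge> (real n ^ 4 - real n ^ 2) / 6 * g0 c p) \<and>
       ((\<exists>c\<in>A. \<exists>p\<in>fst c. gf_qn1 n Q h c p = (real n ^ 4 - real n ^ 2) / 6 * g0 c p)
          \<longrightarrow> (\<forall>c\<in>A. \<forall>p\<in>fst c. Q c p = 0)))"
proof (rule conjI; intro allI impI; elim conjE)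
  fix n :: nat and Q :: "'a chart \<Rightarrow> 'a \<Rightarrow> complex" and h :: "nat \<Rightarrow> 'a sect"
  assume n: "n \<ge> 3" and sys: "qn_system A n Q h"
  interpret toda_chain A g0 n "toda_T n h"
    "\<lambda>k c p. if k = 1 then (h 1 c p)\<^sup>2 * (cmod (Q c p))\<^sup>2 else 0"
    by (rule qn_toda_chain[OF assms n sys])
  have gf: "gf_qn n Q h c p = 2 * real n * ((h 1 c p)\<^sup>2 * (cmod (Q c p))\<^sup>2 +
      (\<Sum>k\<in>{1..n div 2}. chain_mult n k * toda_T n h k c p))" for c p
    unfolding gf_qn_def by (simp only: gf_bracket_conv_toda_T[OF n, symmetric] add.assoc)
  have one: "1 \<in> {1..n div 2}" using n by auto
  show "(\<forall>c\<in>A. \<forall>p\<in>fst c. gf_qn n Q h c p \<ge> (real n ^ 4 - real n ^ 2) / 6 * g0 c p) \<and>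
       ((\<exists>c\<in>A. \<exists>p\<in>fst c. gf_qn n Q h c p = (real n ^ 4 - real n ^ 2) / 6 * g0 c p)
          \<longrightarrow> (\<forall>c\<in>A. \<forall>p\<in>fst c. Q c p = 0))"
  proof (intro conjI ballI impI)
    show "gf_qn n Q h c p \<ge> (real n ^ 4 - real n ^ 2) / 6 * g0 c p" if "c \<in> A" "p \<in> fst c" for c p
      by (rule fuchsian_domination[OF that _ gf]) simp
  next
    fix c p assume c: "c \<in> A" "p \<in> fst c"
    assume "\<exists>c\<in>A. \<exists>p\<in>fst c. gf_qn n Q h c p = (real n ^ 4 - real n ^ 2) / 6 * g0 c p"
    then obtain c0 p0 where c0: "c0 \<in> A" "p0 \<in> fst c0"
      and eq: "gf_qn n Q h c0 p0 = (real n ^ 4 - real n ^ 2) / 6 * g0 c0 p0" by blast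
    have "toda_T n h 1 c0 p0 = fuchsian_weight n 1 * g0 c0 p0"
      by (rule fuchsian_domination_eq[OF c0 _ gf eq one]) simp
    from fuchsian_rigidity[OF one c0 this c] show "Q c p = 0"
      using metrics_okD(2)[OF _ one c, of h] sys unfolding qn_system_def by auto
  qed
next
  fix n :: nat and Q :: "'a chart \<Rightarrow> 'a \<Rightarrow> complex" and h :: "nat \<Rightarrow> 'a sect"
  assume n: "n \<ge> 4" and sys: "qn1_system A n Q h"
  interpret toda_chain A g0 n "toda_T n h" "\<lambda>k c p. if k = 2
    then (if n = 4 then 2 else 1) * (h 1 c p * h 2 c p * (cmod (Q c p))\<^sup>2) else 0"
    by (rule qn1_toda_chain[OF assms n sys])
  have n3: "n \<ge> 3" using n by simp
  have gf: "gf_qn1 n Q h c p = 2 * real n * (2 * h 1 c p * h 2 c p * (cmod (Q c p))\<^sup>2 +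
      (\<Sum>k\<in>{1..n div 2}. chain_mult n k * toda_T n h k c p))" for c p
    unfolding gf_qn1_def by (simp only: gf_bracket_conv_toda_T[OF n3, symmetric] add.assoc)
  have one: "1 \<in> {1..n div 2}" and two: "2 \<in> {1..n div 2}" using n by auto
  have ok: "metrics_ok A n h" using sys unfolding qn1_system_def by simp
  have pos: "h 1 c p > 0" "h 2 c p > 0" if "c \<in> A" "p \<in> fst c" for c p
    using metrics_okD(2)[OF ok one that] metrics_okD(2)[OF ok two that] .
  show "(\<forall>c\<in>A. \<forall>p\<in>fst c. gf_qn1 n Q h c p \<ge> (real n ^ 4 - real n ^ 2) / 6 * g0 c p) \<and>
       ((\<exists>c\<in>A. \<exists>p\<in>fst c. gf_qn1 n Q h c p = (real n ^ 4 - real n ^ 2) / 6 * g0 c p)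
          \<longrightarrow> (\<forall>c\<in>A. \<forall>p\<in>fst c. Q c p = 0))"
  proof (intro conjI ballI impI)
    show "gf_qn1 n Q h c p \<ge> (real n ^ 4 - real n ^ 2) / 6 * g0 c p" if "c \<in> A" "p \<in> fst c" for c p
      by (rule fuchsian_domination[OF that _ gf]) (use pos[OF that] in simp)
  next
    fix c p assume c: "c \<in> A" "p \<in> fst c"
    assume "\<exists>c\<in>A. \<exists>p\<in>fst c. gf_qn1 n Q h c p = (real n ^ 4 - real n ^ 2) / 6 * g0 c p"
    then obtain c0 p0 where c0: "c0 \<in> A" "p0 \<in> fst c0"
      and eq: "gf_qn1 n Q h c0 p0 = (real n ^ 4 - real n ^ 2) / 6 * g0 c0 p0" by blast
    have "toda_T n h 2 c0 p0 = fuchsian_weight n 2 * g0 c0 p0"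
      by (rule fuchsian_domination_eq[OF c0 _ gf eq two]) (use pos[OF c0] in simp)
    from fuchsian_rigidity[OF two c0 this c] show "Q c p = 0"
      using pos[OF c] by (auto split: if_splits)
  qed
qed

end
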